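(* Let $(\omega(n))_{n\in\mathbb Z}$ be crystal weights such that $(\omega(n))_{n\ge0}$ is eventually decreasing, i.e. $\omega(n+1)\le\omega(n)$ for all sufficiently large $n$, and let $H$ be the associated crystal. Then dispersion cannot be faster than $1/t$, that is, $$\limsup_{t\to\infty}\Big(t\,\|e^{-itH}\|_{\ell^1(\mathbb Z)\to\ell^\infty(\mathbb Z)}\Big)>0.$$
   Context: Crystal weights are a sequence $(\omega(n))_{n\in\mathbb Z}\in\ell^1(\mathbb Z)$ with $\omega(n)\ge0$ and $\omega(-n)=\omega(n)$; the associated crystal is the bounded self-adjoint operator on $\ell^2(\mathbb Z)$ given by $(Hu)(n)=\sum_{k\in\mathbb Z}\omega(k)u(n+k)$. Here $\|A\|_{\ell^1\to\ell^\infty}=\sup_{n,m\in\mathbb Z}|\langle\delta_n,A\delta_m\rangle|$. *)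

theory Defs
  imports "HOL-Analysis.Analysis"
begin

section \<open>The complex Hilbert space of square-summable families\<close>

typedef 'a ell2 = "{u :: 'a \<Rightarrow> complex. (\<lambda>i. (cmod (u i))\<^sup>2) summable_on UNIV}"
  morphisms coord Abs_ell2
  by (rule exI[of _ "\<lambda>_. 0"]) simp

setup_lifting type_definition_ell2

lemma coord_summable: "(\<lambda>i. (cmod (coord u i))\<^sup>2) summable_on UNIV"
  using coord[of u] by simp

lemma ell2_eqI: "(\<And>i. coord u i = coord v i) \<Longrightarrow> u = v"
  by (metis coord_inject ext)

lemma cnj_mult_abs_summable:
  assumes "(\<lambda>i. (cmod (u i))\<^sup>2) summable_on UNIV" "(\<lambda>i. (cmod (v i))\<^sup>2) summable_on UNIV"
  shows "(\<lambda>i. norm (cnj (u i) * v i)) summable_on UNIV"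
proof (rule Infinite_Sum.abs_summable_on_comparison_test')
  show "(\<lambda>i. (cmod (u i))\<^sup>2 + (cmod (v i))\<^sup>2) summable_on UNIV"
    using assms by (rule summable_on_add)
  fix i
  have "2 * cmod (u i) * cmod (v i) \<le> (cmod (u i))\<^sup>2 + (cmod (v i))\<^sup>2"
    by (rule sum_squares_bound)
  moreover have "0 \<le> cmod (u i) * cmod (v i)" by simp
  ultimately show "norm (cnj (u i) * v i) \<le> (cmod (u i))\<^sup>2 + (cmod (v i))\<^sup>2"
    unfolding norm_mult complex_mod_cnj by linarith
qed

lemma ell2_add_closed:
  assumes "(\<lambda>i. (cmod (u i))\<^sup>2) summable_on UNIV" "(\<lambda>i. (cmod (v i))\<^sup>2) summable_on UNIV"
  shows "(\<lambda>i. (cmod (u i + v i))\<^sup>2) summable_on UNIV"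
proof (rule summable_on_comparison_test)
  show "(\<lambda>i. 2 * ((cmod (u i))\<^sup>2 + (cmod (v i))\<^sup>2)) summable_on UNIV"
    using assms by (intro summable_on_cmult_right summable_on_add)
  fix i
  have "(cmod (u i + v i))\<^sup>2 \<le> (cmod (u i) + cmod (v i))\<^sup>2"
    by (intro power_mono norm_triangle_ineq norm_ge_zero)
  also have "\<dots> \<le> 2 * ((cmod (u i))\<^sup>2 + (cmod (v i))\<^sup>2)"
    using sum_squares_bound[of "cmod (u i)" "cmod (v i)"] by (simp add: power2_sum)
  finally show "(cmod (u i + v i))\<^sup>2 \<le> 2 * ((cmod (u i))\<^sup>2 + (cmod (v i))\<^sup>2)" .
qed simp

lemma ell2_scale_closed:
  assumes "(\<lambda>i. (cmod (u i))\<^sup>2) summable_on UNIV"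
  shows "(\<lambda>i. (cmod (c * u i))\<^sup>2) summable_on UNIV"
  using assms by (simp add: norm_mult power_mult_distrib summable_on_cmult_right)

instantiation ell2 :: (type) real_vector
begin

lift_definition zero_ell2 :: "'a ell2" is "\<lambda>_. 0" by simp
lift_definition plus_ell2 :: "'a ell2 \<Rightarrow> 'a ell2 \<Rightarrow> 'a ell2" is "\<lambda>u v i. u i + v i"
  by (rule ell2_add_closed)
lift_definition uminus_ell2 :: "'a ell2 \<Rightarrow> 'a ell2" is "\<lambda>u i. - u i" by simp
lift_definition minus_ell2 :: "'a ell2 \<Rightarrow> 'a ell2 \<Rightarrow> 'a ell2" is "\<lambda>u v i. u i - v i"
  subgoal for u v using ell2_add_closed[of u "\<lambda>i. - v i"] by simp done
lift_definition scaleR_ell2 :: "real \<Rightarrow> 'a ell2 \<Rightarrow> 'a ell2" is "\<lambda>r u i. complex_of_real r * u i"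
  by (rule ell2_scale_closed)

instance
  by standard (transfer; simp add: algebra_simps fun_eq_iff)+

end

lemmas coord_simps [simp] =
  zero_ell2.rep_eq plus_ell2.rep_eq uminus_ell2.rep_eq minus_ell2.rep_eq scaleR_ell2.rep_eq

text \<open>The inner product is antilinear in its first argument.\<close>

definition cinner :: "'a ell2 \<Rightarrow> 'a ell2 \<Rightarrow> complex" where
  "cinner u v = (\<Sum>\<^sub>\<infinity>i. cnj (coord u i) * coord v i)"

lemma cinner_summable: "(\<lambda>i. cnj (coord u i) * coord v i) summable_on UNIV"
  by (rule abs_summable_summable, rule cnj_mult_abs_summable) (rule coord_summable)+

lemma cinner_add_left: "cinner (u + v) w = cinner u w + cinner v w"
  unfolding cinner_def
  by (subst infsum_add[symmetric]) (auto simp: cinner_summable distrib_right)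

lemma cinner_scaleR_left: "cinner (r *\<^sub>R u) v = complex_of_real r * cinner u v"
  unfolding cinner_def
  by (subst infsum_cmult_right[symmetric]) (auto simp: cinner_summable mult.assoc)

lemma cinner_commute: "cinner u v = cnj (cinner v u)"
  unfolding cinner_def by (simp flip: infsum_cnj add: mult.commute)

lemma cinner_same: "cinner u u = complex_of_real (\<Sum>\<^sub>\<infinity>i. (cmod (coord u i))\<^sup>2)"
proof -
  have "cinner u u = (\<Sum>\<^sub>\<infinity>i. complex_of_real ((cmod (coord u i))\<^sup>2))"
    unfolding cinner_def by (intro infsum_cong) (metis complex_norm_square mult.commute)
  also have "\<dots> = complex_of_real (\<Sum>\<^sub>\<infinity>i. (cmod (coord u i))\<^sup>2)"
    by (intro infsumI has_sum_of_real has_sum_infsum coord_summable)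
  finally show ?thesis .
qed

instantiation ell2 :: (type) real_inner
begin

definition inner_ell2 :: "'a ell2 \<Rightarrow> 'a ell2 \<Rightarrow> real" where
  "inner_ell2 u v = Re (cinner u v)"
definition norm_ell2 :: "'a ell2 \<Rightarrow> real" where
  "norm_ell2 u = sqrt (\<Sum>\<^sub>\<infinity>i. (cmod (coord u i))\<^sup>2)"
definition sgn_ell2 :: "'a ell2 \<Rightarrow> 'a ell2" where
  "sgn_ell2 u = u /\<^sub>R norm u"
definition dist_ell2 :: "'a ell2 \<Rightarrow> 'a ell2 \<Rightarrow> real" where
  "dist_ell2 u v = norm (u - v)"
definition uniformity_ell2 :: "('a ell2 \<times> 'a ell2) filter" where
  "uniformity_ell2 = (INF e\<in>{0<..}. principal {(u, v). dist u v < e})"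
definition open_ell2 :: "'a ell2 set \<Rightarrow> bool" where
  "open_ell2 U = (\<forall>u\<in>U. eventually (\<lambda>(u', v). u' = u \<longrightarrow> v \<in> U) uniformity)"

instance
proof
  fix u v w :: "'a ell2" and r :: real
  show "inner u v = inner v u"
    unfolding inner_ell2_def by (subst cinner_commute) simp
  show "inner (u + v) w = inner u w + inner v w"
    by (simp add: inner_ell2_def cinner_add_left)
  show "inner (r *\<^sub>R u) v = r * inner u v"
    by (simp add: inner_ell2_def cinner_scaleR_left)
  show "0 \<le> inner u u"
    by (simp add: inner_ell2_def cinner_same infsum_nonneg)
  show "inner u u = 0 \<longleftrightarrow> u = 0"
  proof
    assume "inner u u = 0"
    then have "(\<Sum>\<^sub>\<infinity>i. (cmod (coord u i))\<^sup>2) \<le> 0"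
      by (simp add: inner_ell2_def cinner_same)
    then have "(cmod (coord u i))\<^sup>2 = 0" for i
      by (rule nonneg_infsum_le_0D[OF _ coord_summable]) auto
    then show "u = 0" by (intro ell2_eqI) simp
  qed (simp add: inner_ell2_def cinner_same)
  show "norm u = sqrt (inner u u)"
    by (simp add: inner_ell2_def cinner_same norm_ell2_def)
qed (rule sgn_ell2_def dist_ell2_def uniformity_ell2_def open_ell2_def)+

end

lemma norm_ell2_square: "(norm (u :: 'a ell2))\<^sup>2 = (\<Sum>\<^sub>\<infinity>i. (cmod (coord u i))\<^sup>2)"
  by (simp add: norm_ell2_def infsum_nonneg)

lemma sum_coord_le_norm: "finite F \<Longrightarrow> (\<Sum>i\<in>F. (cmod (coord u i))\<^sup>2) \<le> (norm u)\<^sup>2"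
  unfolding norm_ell2_square by (intro finite_sum_le_infsum coord_summable) auto

lemma coord_le_norm: "cmod (coord u i) \<le> norm u"
  using sum_coord_le_norm[of "{i}" u] by (simp add: power2_le_iff_abs_le)

lemma bounded_linear_coord: "bounded_linear (\<lambda>u. coord u i)"
  by (rule bounded_linear_intro[where K = 1]) (auto simp: scaleR_conv_of_real coord_le_norm)

instance ell2 :: (type) banach
proof
  fix X :: "nat \<Rightarrow> 'a ell2"
  assume X: "Cauchy X"
  define L where "L i = lim (\<lambda>n. coord (X n) i)" for i
  have L: "(\<lambda>n. coord (X n) i) \<longlonglongrightarrow> L i" for i
    unfolding L_def using bounded_linear.Cauchy[OF bounded_linear_coord X]
    by (simp add: Cauchy_convergent_iff convergent_LIMSEQ_iff)
  have bound: "\<exists>N. \<forall>n\<ge>N. \<forall>F. finite F \<longrightarrow> (\<Sum>i\<in>F. (cmod (coord (X n) i - L i))\<^sup>2) \<le> e\<^sup>2"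
    if "e > 0" for e
  proof -
    obtain N where N: "\<And>m n. m \<ge> N \<Longrightarrow> n \<ge> N \<Longrightarrow> norm (X m - X n) < e"
      using CauchyD[OF X \<open>e > 0\<close>] by blast
    have "(\<Sum>i\<in>F. (cmod (coord (X n) i - L i))\<^sup>2) \<le> e\<^sup>2" if "n \<ge> N" "finite F" for n F
    proof (rule LIMSEQ_le_const2)
      show "(\<lambda>m. \<Sum>i\<in>F. (cmod (coord (X n) i - coord (X m) i))\<^sup>2)
              \<longlonglongrightarrow> (\<Sum>i\<in>F. (cmod (coord (X n) i - L i))\<^sup>2)"
        by (intro tendsto_intros L)
      show "\<exists>M. \<forall>m\<ge>M. (\<Sum>i\<in>F. (cmod (coord (X n) i - coord (X m) i))\<^sup>2) \<le> e\<^sup>2"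
      proof (intro exI allI impI)
        fix m assume "m \<ge> N"
        have "(\<Sum>i\<in>F. (cmod (coord (X n) i - coord (X m) i))\<^sup>2) \<le> (norm (X n - X m))\<^sup>2"
          using sum_coord_le_norm[OF \<open>finite F\<close>, of "X n - X m"] by simp
        also have "\<dots> \<le> e\<^sup>2"
          using N[OF \<open>n \<ge> N\<close> \<open>m \<ge> N\<close>] by (intro power_mono) auto
        finally show "(\<Sum>i\<in>F. (cmod (coord (X n) i - coord (X m) i))\<^sup>2) \<le> e\<^sup>2" .
      qed
    qed
    then show ?thesis by blast
  qed
  have diff: "(\<lambda>i. (cmod (coord (X n) i - L i))\<^sup>2) summable_on UNIV"
    if "\<And>F. finite F \<Longrightarrow> (\<Sum>i\<in>F. (cmod (coord (X n) i - L i))\<^sup>2) \<le> e" for n e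
    using that by (intro nonneg_bdd_above_summable_on bdd_aboveI2[where M = e]) auto
  obtain N where N: "\<And>F. finite F \<Longrightarrow> (\<Sum>i\<in>F. (cmod (coord (X N) i - L i))\<^sup>2) \<le> 1"
    using bound[of 1] by auto
  have "(\<lambda>i. (cmod (L i - coord (X N) i))\<^sup>2) summable_on UNIV"
    using diff[OF N] by (simp add: norm_minus_commute)
  from ell2_add_closed[OF this coord_summable[of "X N"]]
  have Lcoord: "coord (Abs_ell2 L) = L"
    by (intro Abs_ell2_inverse) simp
  have "X \<longlonglongrightarrow> Abs_ell2 L"
  proof (rule LIMSEQ_I)
    fix r :: real assume "r > 0"
    then obtain N where N:
      "\<And>n F. n \<ge> N \<Longrightarrow> finite F \<Longrightarrow> (\<Sum>i\<in>F. (cmod (coord (X n) i - L i))\<^sup>2) \<le> (r/2)\<^sup>2"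
      using bound[of "r/2"] by auto
    have "norm (X n - Abs_ell2 L) < r" if "n \<ge> N" for n
    proof -
      have "(norm (X n - Abs_ell2 L))\<^sup>2 \<le> (r/2)\<^sup>2"
        unfolding norm_ell2_square
        by (rule infsum_le_finite_sums[OF coord_summable]) (simp add: Lcoord N[OF that])
      then have "norm (X n - Abs_ell2 L) \<le> r/2"
        using \<open>r > 0\<close> by (simp add: power2_le_iff_abs_le)
      then show ?thesis using \<open>r > 0\<close> by simp
    qed
    then show "\<exists>N. \<forall>n\<ge>N. norm (X n - Abs_ell2 L) < r" by blast
  qed
  then show "convergent X" by (auto simp: convergent_def)
qed

lift_definition delta :: "'a \<Rightarrow> 'a ell2" is "\<lambda>n i. if i = n then 1 else 0"
proof -
  fix n :: 'a
  have "(\<lambda>i. (cmod (if i = n then 1 else 0))\<^sup>2) summable_on {n}" by simp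
  then show "(\<lambda>i. (cmod (if i = n then 1 else 0))\<^sup>2) summable_on UNIV"
    by (rule summable_on_cong_neutral[THEN iffD1, rotated -1]) auto
qed

lemma cinner_delta_left: "cinner (delta n) u = coord u n"
proof -
  have "cinner (delta n) u = (\<Sum>\<^sub>\<infinity>i\<in>{n}. cnj (coord (delta n) i) * coord u i)"
    unfolding cinner_def by (intro infsum_cong_neutral) (auto simp: delta.rep_eq)
  then show ?thesis by (simp add: delta.rep_eq)
qed


section \<open>Bounded operators\<close>

text \<open>Multiplication by a complex scalar. The library's type of bounded linear maps is only real
  linear, so the complex multiple \<open>c A\<close> of an operator is written \<open>scalar_op c o\<^sub>L A\<close>.\<close>

lift_definition cscale :: "complex \<Rightarrow> 'a ell2 \<Rightarrow> 'a ell2" is "\<lambda>c u i. c * u i"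
  by (rule ell2_scale_closed)

lemma norm_cscale: "norm (cscale c u) = cmod c * norm u"
proof -
  have "(norm (cscale c u))\<^sup>2 = (cmod c * norm u)\<^sup>2"
    unfolding power_mult_distrib norm_ell2_square cscale.rep_eq norm_mult
    by (rule infsum_cmult_right) (rule coord_summable)
  then show ?thesis by (simp add: power2_eq_iff_nonneg)
qed

lift_definition scalar_op :: "complex \<Rightarrow> 'a ell2 \<Rightarrow>\<^sub>L 'a ell2" is cscale
  by (rule bounded_linear_intro[where K = "cmod c" for c])
    (auto intro!: ell2_eqI simp: cscale.rep_eq algebra_simps norm_cscale)

text \<open>The operator exponential, as a power series converging in operator norm.\<close>

definition op_exp :: "('a::banach \<Rightarrow>\<^sub>L 'a) \<Rightarrow> 'a \<Rightarrow>\<^sub>L 'a" where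
  "op_exp A = (\<Sum>k. (((o\<^sub>L) A) ^^ k) id_blinfun /\<^sub>R fact k)"

lemma norm_op_power_le:
  fixes A :: "'a::banach \<Rightarrow>\<^sub>L 'a"
  shows "norm ((((o\<^sub>L) A) ^^ k) id_blinfun) \<le> norm A ^ k"
proof (induction k)
  case 0
  show ?case by (auto intro!: norm_blinfun_bound)
next
  case (Suc k)
  have "norm ((((o\<^sub>L) A) ^^ Suc k) id_blinfun) \<le> norm A * norm ((((o\<^sub>L) A) ^^ k) id_blinfun)"
    by (simp add: norm_blinfun_compose)
  also have "\<dots> \<le> norm A ^ Suc k"
    using Suc.IH by (simp add: mult_left_mono)
  finally show ?case .
qed

lemma op_exp_sums:
  fixes A :: "'a::banach \<Rightarrow>\<^sub>L 'a"
  shows "(\<lambda>k. (((o\<^sub>L) A) ^^ k) id_blinfun /\<^sub>R fact k) sums op_exp A"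
  unfolding op_exp_def
proof (rule summable_sums, rule summable_comparison_test')
  show "summable (\<lambda>k. norm A ^ k /\<^sub>R fact k)" by (rule summable_exp_generic)
  show "norm ((((o\<^sub>L) A) ^^ k) id_blinfun /\<^sub>R fact k) \<le> norm A ^ k /\<^sub>R fact k" for k
    using norm_op_power_le[where A = A and k = k] by (simp add: divide_right_mono mult_left_mono)
qed

definition l1_linf_norm :: "('a ell2 \<Rightarrow>\<^sub>L 'a ell2) \<Rightarrow> ereal" where
  "l1_linf_norm A = (SUP (n, m). ereal (cmod (cinner (delta n) (blinfun_apply A (delta m)))))"


section \<open>Crystals\<close>

definition crystal_weights :: "(int \<Rightarrow> real) \<Rightarrow> bool" where
  "crystal_weights \<omega> \<longleftrightarrow>
     (\<lambda>n. \<bar>\<omega> n\<bar>) summable_on UNIV \<and> (\<forall>n. 0 \<le> \<omega> n) \<and> (\<forall>n. \<omega> (- n) = \<omega> n)"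

text \<open>Both \<open>Blinfun\<close> and \<open>Abs_ell2\<close> are applied inside their proper domains when
  \<open>\<omega>\<close> is summable; see \<open>coord_crystal\<close> below.\<close>

definition crystal :: "(int \<Rightarrow> real) \<Rightarrow> int ell2 \<Rightarrow>\<^sub>L int ell2" where
  "crystal \<omega> =
     Blinfun (\<lambda>u. Abs_ell2 (\<lambda>n. \<Sum>\<^sub>\<infinity>k. complex_of_real (\<omega> k) * coord u (n + k)))"

lift_definition shift :: "int \<Rightarrow> int ell2 \<Rightarrow> int ell2" is "\<lambda>k u n. u (n + k)"
  subgoal for k u
    using summable_on_reindex_bij_betw[of "\<lambda>n. n + k" UNIV UNIV "\<lambda>n. (cmod (u n))\<^sup>2"]
    by (simp add: bij_plus_right)
  done

lemma norm_shift: "norm (shift k u) = norm u"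
  unfolding norm_ell2_def shift.rep_eq
  using infsum_reindex_bij_betw[of "\<lambda>n. n + k" UNIV UNIV "\<lambda>n. (cmod (coord u n))\<^sup>2"]
  by (simp add: bij_plus_right)

lift_definition shift_op :: "int \<Rightarrow> int ell2 \<Rightarrow>\<^sub>L int ell2" is shift
  by (rule bounded_linear_intro[where K = 1])
    (auto intro!: ell2_eqI simp: shift.rep_eq norm_shift)

lemma
  assumes "(\<lambda>n. \<bar>\<omega> n\<bar>) summable_on UNIV"
  shows shift_summable: "(\<lambda>k. norm (\<omega> k *\<^sub>R shift_op k)) summable_on UNIV"
    and crystal_eq_shifts: "crystal \<omega> = (\<Sum>\<^sub>\<infinity>k. \<omega> k *\<^sub>R shift_op k)"
    and coord_crystal: "coord (blinfun_apply (crystal \<omega>) u) n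
      = (\<Sum>\<^sub>\<infinity>k. complex_of_real (\<omega> k) * coord u (n + k))"
proof -
  have le: "norm (shift_op k) \<le> 1" for k
    by (rule norm_blinfun_bound) (auto simp: shift_op.rep_eq norm_shift)
  show summ: "(\<lambda>k. norm (\<omega> k *\<^sub>R shift_op k)) summable_on UNIV"
    using assms by (rule Infinite_Sum.abs_summable_on_comparison_test') (simp add: le mult_left_le)
  define H where "H = (\<Sum>\<^sub>\<infinity>k. \<omega> k *\<^sub>R shift_op k)"
  have coord_H: "coord (blinfun_apply H u) n = (\<Sum>\<^sub>\<infinity>k. complex_of_real (\<omega> k) * coord u (n + k))"
    for u n
  proof -
    have "bounded_linear (\<lambda>A. coord (blinfun_apply A u) n)"
      by (intro bounded_linear_compose[OF bounded_linear_coord] blinfun.bounded_linear_left)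
    from infsumI[OF has_sum_bounded_linear[OF this has_sum_infsum[OF abs_summable_summable[OF summ]]]]
    show ?thesis
      by (simp add: H_def o_def blinfun.scaleR_left shift_op.rep_eq shift.rep_eq)
  qed
  have "(\<lambda>u. Abs_ell2 (\<lambda>n. \<Sum>\<^sub>\<infinity>k. complex_of_real (\<omega> k) * coord u (n + k))) = blinfun_apply H"
    by (simp add: coord_H[symmetric] coord_inverse)
  then show eq: "crystal \<omega> = H"
    by (simp add: crystal_def blinfun_apply_inverse)
  show "coord (blinfun_apply (crystal \<omega>) u) n
      = (\<Sum>\<^sub>\<infinity>k. complex_of_real (\<omega> k) * coord u (n + k))"
    by (simp add: eq coord_H)
qed

end

theory Submission
  imports Defs
begin

text \<open>
  Write \<open>U = exp (-itH)\<close> and apply it to the dipole \<open>g = \<delta>\<^sub>1 - \<delta>\<^sub>0\<close>. Since \<open>U\<close> is unitary,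
  \<open>U g\<close> has squared norm \<open>2\<close>. The claim follows once at least half of this mass is found on a set of
  \<open>O(t\<^sup>2)\<close> sites: some entry of \<open>U g\<close> is then at least a constant times \<open>1/t\<close>, and every entry of
  \<open>U g\<close> is the difference of two matrix entries of \<open>U\<close>. This localization is
  \<open>propagator_mass_quadratic_window\<close>, and it rests on two approximations.

  First, the weights can be cut off at a range \<open>N\<close> proportional to \<open>t\<close>. In general, dropping the
  weights beyond \<open>N\<close> changes \<open>H\<close> by an operator whose norm tends to zero at no particular rate, but
  on the dipole it acts as a discrete derivative: \<open>(H - H\<^sub>N) g\<close> has the entries
  \<open>\<rho> (1 - n) - \<rho> (- n)\<close>, where \<open>\<rho>\<close> is the tail of the weights. For decreasing weights the squares of
  these differences telescope, so the norm is at most \<open>2 \<omega> (N + 1)\<close> (\<open>sum_sq_diff_tail_le\<close>), and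
  summability together with monotonicity gives \<open>\<omega> (N + 1) = O(1/N)\<close> (\<open>decreasing_weight_bound\<close>). As
  \<open>H\<close> and \<open>H\<^sub>N\<close> commute and generate unitary groups, the propagators differ on \<open>g\<close> by an
  amount controlled by \<open>t\<close> times this norm (\<open>op_exp_diff_skew_commuting\<close>), with no exponential loss
  in \<open>t\<close>; this is small when \<open>N\<close> is a large multiple of \<open>t\<close>.

  Secondly, the power series of \<open>exp (-itH\<^sub>N)\<close> can be cut after \<open>L = O(t)\<close> terms, since the norm of
  \<open>t H\<^sub>N\<close> is at most \<open>t\<close> times the \<open>\<ell>\<^sup>1\<close> norm of the weights (\<open>op_exp_tail_bound\<close>). Each application
  of \<open>H\<^sub>N\<close> moves the support by at most \<open>N\<close>, so what remains lives on \<open>\<bar>n\<bar> \<le> 1 + L N = O(t\<^sup>2)\<close>.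
\<close>

section \<open>The exponential of a skew operator\<close>

abbreviation op_power :: "('a::banach \<Rightarrow>\<^sub>L 'a) \<Rightarrow> nat \<Rightarrow> 'a \<Rightarrow>\<^sub>L 'a" where
  "op_power A k \<equiv> (((o\<^sub>L) A) ^^ k) id_blinfun"

lemma op_power_scaleR: "op_power (s *\<^sub>R A) k = s ^ k *\<^sub>R op_power A k"
  by (induction k) (auto intro!: blinfun_eqI simp: blinfun.scaleR_left blinfun.scaleR_right)

lemma op_power_commute:
  assumes "A o\<^sub>L B = B o\<^sub>L A"
  shows "op_power A k o\<^sub>L B = B o\<^sub>L op_power A k"
proof (induction k)
  case 0
  show ?case by (auto intro!: blinfun_eqI)
next
  case (Suc k)
  have "op_power A k (B v) = B (op_power A k v)" "A (B v) = B (A v)" for v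
    using Suc assms by (metis blinfun_apply_blinfun_compose)+
  then show ?case by (auto intro!: blinfun_eqI)
qed

lemma op_exp_commute:
  assumes "A o\<^sub>L B = B o\<^sub>L A"
  shows "op_exp A o\<^sub>L B = B o\<^sub>L op_exp A"
proof (rule sums_unique2)
  show "(\<lambda>k. (op_power A k /\<^sub>R fact k) o\<^sub>L B) sums (op_exp A o\<^sub>L B)"
    by (rule bounded_linear.sums[OF bounded_bilinear.bounded_linear_left
          [OF bounded_bilinear_blinfun_compose] op_exp_sums])
  have "(\<lambda>k. B o\<^sub>L (op_power A k /\<^sub>R fact k)) sums (B o\<^sub>L op_exp A)"
    by (rule bounded_linear.sums[OF bounded_bilinear.bounded_linear_right
          [OF bounded_bilinear_blinfun_compose] op_exp_sums])
  moreover have "(op_power A k /\<^sub>R fact k) o\<^sub>L B = B o\<^sub>L (op_power A k /\<^sub>R fact k)" for k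
    using op_power_commute[OF assms, of k]
    by (simp add: bounded_bilinear.scaleR_left[OF bounded_bilinear_blinfun_compose]
        bounded_bilinear.scaleR_right[OF bounded_bilinear_blinfun_compose])
  ultimately show "(\<lambda>k. (op_power A k /\<^sub>R fact k) o\<^sub>L B) sums (B o\<^sub>L op_exp A)"
    by simp
qed

lemma op_exp_zero: "op_exp (0 :: 'a::banach \<Rightarrow>\<^sub>L 'a) = id_blinfun"
proof (rule sums_unique2[OF op_exp_sums])
  have "op_power (0 :: 'a \<Rightarrow>\<^sub>L 'a) k = 0" if "k \<noteq> 0" for k
    using that by (cases k) auto
  then have "(\<lambda>k. op_power (0 :: 'a \<Rightarrow>\<^sub>L 'a) k /\<^sub>R fact k) sums
          (\<Sum>k\<in>{0}. op_power (0 :: 'a \<Rightarrow>\<^sub>L 'a) k /\<^sub>R fact k)"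
    by (intro sums_finite) auto
  then show "(\<lambda>k. op_power (0 :: 'a \<Rightarrow>\<^sub>L 'a) k /\<^sub>R fact k) sums id_blinfun"
    by simp
qed

text \<open>Chernoff's trick: for \<open>k \<ge> L\<close> the factor \<open>(1/2) ^ L * 2 ^ k\<close> is at least \<open>1\<close>. Inserting it
  turns the tail into the exponential series at \<open>2 * norm A\<close> and makes it small as soon as \<open>L\<close> is a
  sufficiently large multiple of \<open>norm A\<close>.\<close>

lemma op_exp_tail_bound:
  "norm (op_exp A - (\<Sum>k<L. op_power A k /\<^sub>R fact k)) \<le> (1/2) ^ L * exp (2 * norm A)"
proof -
  let ?f = "\<lambda>k. op_power A k /\<^sub>R fact k"
  have "(\<lambda>k. ?f k - (if k < L then ?f k else 0)) sums (op_exp A - (\<Sum>k<L. ?f k))"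
    using sums_If_finite_set[of "{..<L}" ?f] by (intro sums_diff op_exp_sums) simp
  moreover have "(\<lambda>k. (1/2) ^ L * ((2 * norm A) ^ k /\<^sub>R fact k)) sums ((1/2) ^ L * exp (2 * norm A))"
    by (intro sums_mult exp_converges)
  moreover have "norm (?f k - (if k < L then ?f k else 0)) \<le> (1/2) ^ L * ((2 * norm A) ^ k /\<^sub>R fact k)" for k
  proof (cases "k < L")
    case False
    have "(2::real) ^ L \<le> 2 ^ k" using False by (intro power_increasing) auto
    then have "norm A ^ k \<le> (1/2) ^ L * (2 * norm A) ^ k"
      by (simp add: power_mult_distrib power_divide divide_simps mult_left_mono mult.commute)
    then have "norm (op_power A k) \<le> (1/2) ^ L * (2 * norm A) ^ k"
      using norm_op_power_le[of k A] by linarith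
    then show ?thesis using False by (simp add: divide_simps)
  qed simp
  ultimately show ?thesis
    by (metis (no_types, lifting) norm_suminf_le sums_summable sums_unique)
qed

text \<open>The series may be differentiated term by term because the differentiated series is \<open>A\<close> times
  the exponential series again, whose tails are small uniformly for bounded \<open>s\<close> by
  \<open>op_exp_tail_bound\<close>.\<close>

lemma op_exp_has_vector_derivative:
  "((\<lambda>s. op_exp (s *\<^sub>R A)) has_vector_derivative (A o\<^sub>L op_exp (s *\<^sub>R A))) (at s)"
proof -
  define r where "r = \<bar>s\<bar> + 1"
  define S where "S = {-r<..<r}"
  have s: "s \<in> S" "open S" "convex S" by (auto simp: S_def r_def)
  let ?f = "\<lambda>k x. (x ^ k / fact k) *\<^sub>R op_power A k"
  have f: "(\<lambda>k. ?f k x) sums op_exp (x *\<^sub>R A)" for x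
    using op_exp_sums[of "x *\<^sub>R A"] by (simp add: op_power_scaleR divide_inverse mult.commute)
  let ?f' = "\<lambda>k x h. (h * (real k * x ^ (k - 1) / fact k)) *\<^sub>R op_power A k"
  \<comment> \<open>The zeroth term has derivative zero, so the derivative of the first \<open>Suc n\<close> terms is \<open>A\<close>
    times the first \<open>n\<close> terms.\<close>
  have psum: "(\<Sum>i<Suc n. ?f' i x h) = h *\<^sub>R (A o\<^sub>L (\<Sum>k<n. op_power (x *\<^sub>R A) k /\<^sub>R fact k))" for n x h
  proof -
    have "(\<Sum>i<Suc n. ?f' i x h) = (\<Sum>i<n. ?f' (Suc i) x h)"
      by (subst sum.lessThan_Suc_shift) simp
    also have "\<dots> = (\<Sum>i<n. h *\<^sub>R (A o\<^sub>L (op_power (x *\<^sub>R A) i /\<^sub>R fact i)))"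
    proof (rule sum.cong[OF refl])
      fix i
      have "real (Suc i) * x ^ i / fact (Suc i) = x ^ i / fact i"
        by (simp add: fact_Suc del: of_nat_Suc)
      then have "?f' (Suc i) x h = (h * (x ^ i / fact i)) *\<^sub>R op_power A (Suc i)"
        by (metis diff_Suc_1)
      also have "\<dots> = h *\<^sub>R (A o\<^sub>L (op_power (x *\<^sub>R A) i /\<^sub>R fact i))"
        by (simp add: op_power_scaleR bounded_bilinear.scaleR_right[OF bounded_bilinear_blinfun_compose]
            field_simps)
      finally show "?f' (Suc i) x h = h *\<^sub>R (A o\<^sub>L (op_power (x *\<^sub>R A) i /\<^sub>R fact i))" .
    qed
    finally show ?thesis
      by (simp add: scaleR_sum_right bounded_bilinear.sum_right[OF bounded_bilinear_blinfun_compose])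
  qed
  have "\<exists>g. \<forall>x\<in>S. (\<lambda>k. ?f k x) sums g x \<and>
      (g has_derivative (\<lambda>h. h *\<^sub>R (A o\<^sub>L op_exp (x *\<^sub>R A)))) (at x within S)"
  proof (rule has_derivative_series[where f' = ?f', OF \<open>convex S\<close> _ _ \<open>s \<in> S\<close> f])
    fix k x
    have "((\<lambda>x. x ^ k / fact k) has_real_derivative (real k * x ^ (k - 1) / fact k)) (at x within S)"
      by (auto intro!: derivative_eq_intros)
    then have "((\<lambda>x. x ^ k / fact k) has_derivative (\<lambda>h. h * (real k * x ^ (k - 1) / fact k))) (at x within S)"
      unfolding has_field_derivative_def
      by (rule has_derivative_eq_rhs) (simp add: fun_eq_iff mult.commute)
    then show "(?f k has_derivative ?f' k x) (at x within S)"
      by (rule bounded_linear.has_derivative[OF bounded_linear_scaleR_left])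
  next
    fix e :: real assume "e > 0"
    let ?C = "norm A * exp (2 * r * norm A)"
    have "(\<lambda>n. ?C * (1/2) ^ n) \<longlonglongrightarrow> ?C * 0"
      by (intro tendsto_mult tendsto_const LIMSEQ_power_zero) auto
    then have "\<forall>\<^sub>F n in sequentially. ?C * (1/2) ^ n < e"
      using \<open>e > 0\<close> by (intro order_tendstoD(2)) auto
    then have "\<forall>\<^sub>F n in sequentially. \<forall>x\<in>S. \<forall>h.
        norm ((\<Sum>i<Suc n. ?f' i x h) - h *\<^sub>R (A o\<^sub>L op_exp (x *\<^sub>R A))) \<le> e * norm h"
    proof eventually_elim
      case (elim n)
      show ?case
      proof (intro ballI allI)
        fix x h assume "x \<in> S"
        let ?P = "\<Sum>k<n. op_power (x *\<^sub>R A) k /\<^sub>R fact k"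
        have x: "\<bar>x\<bar> * norm A \<le> r * norm A"
          using \<open>x \<in> S\<close> by (intro mult_right_mono) (auto simp: S_def)
        have "norm (?P - op_exp (x *\<^sub>R A)) \<le> (1/2) ^ n * exp (2 * norm (x *\<^sub>R A))"
          using op_exp_tail_bound[of "x *\<^sub>R A" n] by (simp add: norm_minus_commute)
        also have "\<dots> \<le> (1/2) ^ n * exp (2 * r * norm A)"
          using x by (intro mult_left_mono) auto
        finally have "norm A * norm (?P - op_exp (x *\<^sub>R A)) \<le> norm A * ((1/2) ^ n * exp (2 * r * norm A))"
          by (intro mult_left_mono) auto
        then have b: "norm (A o\<^sub>L (?P - op_exp (x *\<^sub>R A))) \<le> e"
          using norm_blinfun_compose[of A "?P - op_exp (x *\<^sub>R A)"] elim by (simp add: mult_ac)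
        have "norm ((\<Sum>i<Suc n. ?f' i x h) - h *\<^sub>R (A o\<^sub>L op_exp (x *\<^sub>R A)))
              = norm h * norm (A o\<^sub>L (?P - op_exp (x *\<^sub>R A)))"
          unfolding psum
          by (simp add: bounded_bilinear.diff_right[OF bounded_bilinear_blinfun_compose]
              flip: scaleR_diff_right norm_scaleR)
        also have "\<dots> \<le> e * norm h"
          using mult_left_mono[OF b, of "norm h"] by (simp add: mult.commute)
        finally show "norm ((\<Sum>i<Suc n. ?f' i x h) - h *\<^sub>R (A o\<^sub>L op_exp (x *\<^sub>R A))) \<le> e * norm h" .
      qed
    qed
    then show "\<forall>\<^sub>F n in sequentially. \<forall>x\<in>S. \<forall>h.
        norm ((\<Sum>i<n. ?f' i x h) - h *\<^sub>R (A o\<^sub>L op_exp (x *\<^sub>R A))) \<le> e * norm h"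
      by (subst (asm) eventually_sequentially_Suc)
  qed
  then obtain g where g: "\<forall>x\<in>S. (\<lambda>k. ?f k x) sums g x \<and>
      (g has_derivative (\<lambda>h. h *\<^sub>R (A o\<^sub>L op_exp (x *\<^sub>R A)))) (at x within S)" ..
  then have deriv: "(g has_vector_derivative (A o\<^sub>L op_exp (s *\<^sub>R A))) (at s)"
    unfolding has_vector_derivative_def using s by (metis at_within_open)
  show ?thesis
    by (rule has_vector_derivative_transform_within_open[OF deriv s(2,1)])
      (rule sums_unique2[OF conjunct1[OF bspec[OF g]] f])
qed

lemma op_exp_apply_has_vector_derivative:
  "((\<lambda>s. op_exp (s *\<^sub>R A) v) has_vector_derivative A (op_exp (s *\<^sub>R A) v)) (at s)"
  using bounded_linear.has_vector_derivative[OF blinfun.bounded_linear_left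
      op_exp_has_vector_derivative[of A s], of v] by simp

text \<open>Skewness makes the derivative of the squared norm along the flow,
  \<open>2 * inner (y s) (A (y s))\<close>, vanish.\<close>

lemma norm_op_exp_skew:
  fixes A :: "'a::{real_inner, banach} \<Rightarrow>\<^sub>L 'a"
  assumes skew: "\<And>u. inner u (A u) = 0"
  shows "norm (op_exp A v) = norm v"
proof -
  let ?y = "\<lambda>s. op_exp (s *\<^sub>R A) v"
  have "((\<lambda>s. inner (?y s) (?y s)) has_real_derivative 0) (at s)" for s
    unfolding has_real_derivative_iff_has_vector_derivative
    using bounded_bilinear.has_vector_derivative[OF bounded_bilinear_inner
        op_exp_apply_has_vector_derivative[of A v s] op_exp_apply_has_vector_derivative[of A v s]]
    by (simp add: skew inner_commute)
  then have "inner (?y 1) (?y 1) = inner (?y 0) (?y 0)"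
    using DERIV_isconst_all by blast
  then show ?thesis
    by (simp add: op_exp_zero norm_eq_sqrt_inner)
qed

text \<open>A Duhamel estimate without integrals. The difference \<open>z\<close> of the two flows satisfies
  \<open>z' = A z + exp (s B) (A g - B g)\<close>, where commutativity has moved \<open>A - B\<close> past the flow of \<open>B\<close>. The
  first term does not contribute to the derivative of \<open>norm z ^ 2\<close>, and in the second both
  exponentials are isometric. Bounding \<open>norm z\<close> by \<open>2 * norm g\<close> avoids a Gronwall argument;
  it costs only the square on the left-hand side.\<close>

lemma op_exp_diff_skew_commuting:
  fixes A B :: "'a::{real_inner, banach} \<Rightarrow>\<^sub>L 'a"
  assumes skewA: "\<And>u. inner u (A u) = 0" and skewB: "\<And>u. inner u (B u) = 0"
    and comm: "A o\<^sub>L B = B o\<^sub>L A"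
  shows "(norm (op_exp A g - op_exp B g))\<^sup>2 \<le> 4 * norm g * norm (A g - B g)"
proof -
  define a where "a s = op_exp (s *\<^sub>R A) g" for s
  define b where "b s = op_exp (s *\<^sub>R B) g" for s
  define z where "z s = a s - b s" for s
  have deriv: "((\<lambda>s. inner (z s) (z s)) has_real_derivative 2 * inner (z s) (A (a s) - B (b s))) (at s)" for s
  proof -
    have "(z has_vector_derivative (A (a s) - B (b s))) (at s)"
      unfolding z_def a_def b_def
      by (intro has_vector_derivative_diff op_exp_apply_has_vector_derivative)
    from bounded_bilinear.has_vector_derivative[OF bounded_bilinear_inner this this]
    show ?thesis
      unfolding has_real_derivative_iff_has_vector_derivative by (simp add: inner_commute)
  qed
  obtain s where "inner (z 1) (z 1) - inner (z 0) (z 0) = (1 - 0) * (2 * inner (z s) (A (a s) - B (b s)))"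
    using MVT2[of 0 1 "\<lambda>s. inner (z s) (z s)", OF _ deriv] by auto
  moreover have "z 0 = 0" by (simp add: z_def a_def b_def)
  ultimately have mvt: "inner (z 1) (z 1) = 2 * inner (z s) (A (a s) - B (b s))" by simp
  have "op_exp (s *\<^sub>R B) o\<^sub>L (A - B) = (A - B) o\<^sub>L op_exp (s *\<^sub>R B)"
    by (rule op_exp_commute)
      (simp add: comm bounded_bilinear.scaleR_left[OF bounded_bilinear_blinfun_compose]
        bounded_bilinear.scaleR_right[OF bounded_bilinear_blinfun_compose]
        bounded_bilinear.diff_left[OF bounded_bilinear_blinfun_compose]
        bounded_bilinear.diff_right[OF bounded_bilinear_blinfun_compose]
        scaleR_diff_right)
  then have "op_exp (s *\<^sub>R B) ((A - B) g) = (A - B) (b s)"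
    unfolding b_def by (metis blinfun_apply_blinfun_compose)
  then have "A (a s) - B (b s) = A (z s) + op_exp (s *\<^sub>R B) (A g - B g)"
    by (simp add: z_def blinfun.diff_right blinfun.diff_left)
  then have "inner (z 1) (z 1) = 2 * inner (z s) (op_exp (s *\<^sub>R B) (A g - B g))"
    using mvt by (simp add: inner_add_right skewA)
  also have "\<dots> \<le> 2 * (norm (z s) * norm (op_exp (s *\<^sub>R B) (A g - B g)))"
    using norm_cauchy_schwarz by (intro mult_left_mono) auto
  also have "norm (op_exp (s *\<^sub>R B) (A g - B g)) = norm (A g - B g)"
    by (rule norm_op_exp_skew) (simp add: blinfun.scaleR_left skewB)
  also have "norm (z s) \<le> 2 * norm g"
  proof -
    have "norm (a s) = norm g" "norm (b s) = norm g"
      unfolding a_def b_def by (rule norm_op_exp_skew; simp add: blinfun.scaleR_left skewA skewB)+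
    then show ?thesis
      unfolding z_def using norm_triangle_ineq4[of "a s" "b s"] by simp
  qed
  finally show ?thesis
    by (simp add: z_def a_def b_def power2_norm_eq_inner mult_right_mono mult_ac)
qed


section \<open>Crystals as superpositions of shifts\<close>

lemma cinner_shift: "cinner u (shift (- k) v) = cinner (shift k u) v"
  unfolding cinner_def shift.rep_eq
  using infsum_reindex_bij_betw[of "\<lambda>n. n + k" UNIV UNIV "\<lambda>i. cnj (coord u i) * coord v (i - k)"]
  by (simp add: bij_plus_right)

lemma crystal_has_sum:
  assumes "(\<lambda>n. \<bar>\<omega> n\<bar>) summable_on UNIV"
  shows "((\<lambda>k. \<omega> k *\<^sub>R shift_op k) has_sum crystal \<omega>) UNIV"
  unfolding crystal_eq_shifts[OF assms]
  by (rule has_sum_infsum[OF abs_summable_summable[OF shift_summable[OF assms]]])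

lemma norm_crystal_le:
  assumes "(\<lambda>n. \<bar>\<omega> n\<bar>) summable_on UNIV"
  shows "norm (crystal \<omega>) \<le> (\<Sum>\<^sub>\<infinity>k. \<bar>\<omega> k\<bar>)"
proof -
  have "norm (crystal \<omega>) \<le> (\<Sum>\<^sub>\<infinity>k. norm (\<omega> k *\<^sub>R shift_op k))"
    unfolding crystal_eq_shifts[OF assms] by (rule norm_infsum_bound[OF shift_summable[OF assms]])
  also have "\<dots> \<le> (\<Sum>\<^sub>\<infinity>k. \<bar>\<omega> k\<bar>)"
  proof (rule infsum_mono[OF shift_summable[OF assms] assms])
    fix k
    have "norm (shift_op k) \<le> 1"
      by (rule norm_blinfun_bound) (auto simp: shift_op.rep_eq norm_shift)
    then show "norm (\<omega> k *\<^sub>R shift_op k) \<le> \<bar>\<omega> k\<bar>"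
      by (simp add: mult_left_le)
  qed
  finally show ?thesis .
qed

lemma cinner_cscale_right: "cinner u (cscale c v) = c * cinner u v"
  unfolding cinner_def cscale.rep_eq
  by (subst infsum_cmult_right'[symmetric]) (simp add: mult_ac)

lemma cscale_scaleR: "cscale c (r *\<^sub>R v) = r *\<^sub>R cscale c v"
  by (rule ell2_eqI) (simp add: cscale.rep_eq)

text \<open>The \<open>k\<close>-th and \<open>-k\<close>-th shifts are adjoint to each other, so with a purely imaginary factor
  their contributions \<open>q k\<close> and \<open>q (- k)\<close> cancel against equal weights.\<close>

lemma inner_crystal_skew:
  assumes "crystal_weights \<omega>"
  shows "inner u ((scalar_op (- (\<i> * complex_of_real t)) o\<^sub>L crystal \<omega>) u) = 0"
proof -
  define c where "c = - (\<i> * complex_of_real t)"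
  define q where "q k = inner u (cscale c (shift k u))" for k
  have "q (- k) = - q k" for k
    using cinner_commute[of "shift k u" u]
    by (simp add: q_def inner_ell2_def cinner_cscale_right cinner_shift c_def)
  moreover have "\<omega> (- k) = \<omega> k" for k
    using assms by (simp add: crystal_weights_def)
  ultimately have "(\<Sum>\<^sub>\<infinity>k. \<omega> k * q k) = - (\<Sum>\<^sub>\<infinity>k. \<omega> k * q k)"
    using infsum_reindex_bij_betw[of uminus UNIV UNIV "\<lambda>k. \<omega> k * q k"]
    by (simp add: bij_uminus infsum_uminus)
  moreover have "bounded_linear (\<lambda>A. inner u ((scalar_op c o\<^sub>L A) u))"
    by (intro bounded_linear_compose[OF bounded_linear_inner_right]
        bounded_linear_compose[OF blinfun.bounded_linear_left]
        bounded_bilinear.bounded_linear_right[OF bounded_bilinear_blinfun_compose])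
  from infsumI[OF has_sum_bounded_linear[OF this crystal_has_sum[of \<omega>]]]
  have "(\<Sum>\<^sub>\<infinity>k. \<omega> k * q k) = inner u ((scalar_op c o\<^sub>L crystal \<omega>) u)"
    using assms conjunct1[OF assms[unfolded crystal_weights_def]]
    by (simp add: o_def q_def crystal_weights_def blinfun.scaleR_left cscale_scaleR
        shift_op.rep_eq scalar_op.rep_eq)
  ultimately show ?thesis by (simp add: c_def)
qed

text \<open>A crystal commutes with every shift, hence with every norm convergent superposition of shifts.\<close>

lemma crystal_commute:
  assumes "(\<lambda>n. \<bar>\<omega> n\<bar>) summable_on UNIV" "(\<lambda>n. \<bar>\<rho> n\<bar>) summable_on UNIV"
  shows "crystal \<omega> o\<^sub>L crystal \<rho> = crystal \<rho> o\<^sub>L crystal \<omega>"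
proof -
  have "crystal \<omega> o\<^sub>L (\<rho> k *\<^sub>R shift_op k) = (\<rho> k *\<^sub>R shift_op k) o\<^sub>L crystal \<omega>" for k
    by (intro blinfun_eqI ell2_eqI)
      (simp add: coord_crystal[OF assms(1)] blinfun.scaleR_left blinfun.scaleR_right
        shift_op.rep_eq shift.rep_eq add_ac)
  moreover have "((\<lambda>k. crystal \<omega> o\<^sub>L (\<rho> k *\<^sub>R shift_op k)) has_sum (crystal \<omega> o\<^sub>L crystal \<rho>)) UNIV"
    by (rule has_sum_bounded_linear[OF bounded_bilinear.bounded_linear_right
        [OF bounded_bilinear_blinfun_compose] crystal_has_sum[OF assms(2)], unfolded o_def])
  moreover have "((\<lambda>k. (\<rho> k *\<^sub>R shift_op k) o\<^sub>L crystal \<omega>) has_sum (crystal \<rho> o\<^sub>L crystal \<omega>)) UNIV"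
    by (rule has_sum_bounded_linear[OF bounded_bilinear.bounded_linear_left
        [OF bounded_bilinear_blinfun_compose] crystal_has_sum[OF assms(2)], unfolded o_def])
  ultimately show ?thesis
    by (simp only: has_sum_unique)
qed

lemma scalar_op_crystal_commute:
  assumes "(\<lambda>n. \<bar>\<omega> n\<bar>) summable_on UNIV"
  shows "scalar_op c o\<^sub>L crystal \<omega> = crystal \<omega> o\<^sub>L scalar_op c"
proof (intro blinfun_eqI ell2_eqI)
  fix u n
  have "(\<Sum>\<^sub>\<infinity>k. complex_of_real (\<omega> k) * (c * coord u (n + k)))
      = c * (\<Sum>\<^sub>\<infinity>k. complex_of_real (\<omega> k) * coord u (n + k))"
    by (subst infsum_cmult_right'[symmetric]) (simp only: mult.left_commute)
  then show "coord ((scalar_op c o\<^sub>L crystal \<omega>) u) n = coord ((crystal \<omega> o\<^sub>L scalar_op c) u) n"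
    by (simp only: blinfun_apply_blinfun_compose coord_crystal[OF assms] scalar_op.rep_eq cscale.rep_eq)
qed

lemma coord_crystal_delta:
  assumes "(\<lambda>n. \<bar>\<omega> n\<bar>) summable_on UNIV"
  shows "coord (crystal \<omega> (delta m)) n = complex_of_real (\<omega> (m - n))"
proof -
  have "coord (crystal \<omega> (delta m)) n
      = (\<Sum>\<^sub>\<infinity>k\<in>{m - n}. complex_of_real (\<omega> k) * coord (delta m) (n + k))"
    unfolding coord_crystal[OF assms] by (intro infsum_cong_neutral) (auto simp: delta.rep_eq)
  then show ?thesis by (simp add: delta.rep_eq)
qed

lemma coord_crystal_finite_range:
  assumes "(\<lambda>n. \<bar>\<omega> n\<bar>) summable_on UNIV" "\<And>k. \<bar>k\<bar> > N \<Longrightarrow> \<omega> k = 0"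
    and "\<And>n. \<bar>n\<bar> > R \<Longrightarrow> coord u n = 0" "\<bar>n\<bar> > R + N"
  shows "coord (crystal \<omega> u) n = 0"
  unfolding coord_crystal[OF assms(1)]
proof (rule infsum_0)
  fix k
  show "complex_of_real (\<omega> k) * coord u (n + k) = 0"
  proof (cases "\<bar>k\<bar> > N")
    case False
    then have "\<bar>n + k\<bar> > R" using assms(4) by linarith
    then show ?thesis using assms(3) by simp
  qed (simp add: assms(2))
qed

lemma coord_op_power_finite_range:
  assumes "(\<lambda>n. \<bar>\<omega> n\<bar>) summable_on UNIV" "\<And>k. \<bar>k\<bar> > N \<Longrightarrow> \<omega> k = 0"
    and "\<And>n. \<bar>n\<bar> > R \<Longrightarrow> coord u n = 0" "\<bar>n\<bar> > R + int k * N"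
  shows "coord (op_power (scalar_op c o\<^sub>L crystal \<omega>) k u) n = 0"
  using assms(4)
proof (induction k arbitrary: n)
  case 0
  then show ?case using assms(3) by simp
next
  case (Suc k)
  have "coord (crystal \<omega> (op_power (scalar_op c o\<^sub>L crystal \<omega>) k u)) n = 0"
    by (rule coord_crystal_finite_range[OF assms(1,2) Suc.IH]) (use Suc.prems in \<open>auto simp: algebra_simps\<close>)
  then show ?case by (simp add: scalar_op.rep_eq cscale.rep_eq)
qed

text \<open>If \<open>u\<close> is close to a vector living on \<open>F\<close>, then \<open>u\<close> carries almost all its mass on \<open>F\<close>:
  off \<open>F\<close> it coincides with \<open>u - v\<close>.\<close>

lemma norm_sq_le_sum_plus_dist_sq:
  assumes "finite F" "\<And>n. n \<notin> F \<Longrightarrow> coord v n = 0"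
  shows "(norm u)\<^sup>2 \<le> (\<Sum>n\<in>F. (cmod (coord u n))\<^sup>2) + (norm (u - v))\<^sup>2"
  unfolding norm_ell2_square[of u]
proof (rule infsum_le_finite_sums[OF coord_summable])
  fix G :: "'a set" assume G: "finite G"
  have "(\<Sum>n\<in>G. (cmod (coord u n))\<^sup>2)
      \<le> (\<Sum>n\<in>F \<union> (G - F). (cmod (coord u n))\<^sup>2)"
    using G assms(1) by (intro sum_mono2) auto
  also have "\<dots> = (\<Sum>n\<in>F. (cmod (coord u n))\<^sup>2) + (\<Sum>n\<in>G - F. (cmod (coord u n))\<^sup>2)"
    using G assms(1) by (intro sum.union_disjoint) auto
  also have "(\<Sum>n\<in>G - F. (cmod (coord u n))\<^sup>2) = (\<Sum>n\<in>G - F. (cmod (coord (u - v) n))\<^sup>2)"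
    using assms(2) by (intro sum.cong) auto
  also have "\<dots> \<le> (norm (u - v))\<^sup>2"
    using G by (intro sum_coord_le_norm) auto
  finally show "(\<Sum>n\<in>G. (cmod (coord u n))\<^sup>2)
      \<le> (\<Sum>n\<in>F. (cmod (coord u n))\<^sup>2) + (norm (u - v))\<^sup>2" by simp
qed

section \<open>Tails of eventually decreasing weights\<close>

lemma decreasing_from:
  fixes \<omega> :: "int \<Rightarrow> real"
  assumes "\<And>n. n \<ge> N0 \<Longrightarrow> \<omega> (n + 1) \<le> \<omega> n" "N0 \<le> m" "m \<le> n"
  shows "\<omega> n \<le> \<omega> m"
  using assms(3)
proof (induction n rule: int_ge_induct)
  case (step i)
  then show ?case using assms(1)[of i] assms(2) by linarith
qed simp

text \<open>The \<open>n - N0\<close> weights between \<open>N0\<close> and \<open>n\<close> are all at least \<open>\<omega> n\<close>, and their sum is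
  finite; this gives \<open>\<omega> n = O(1/n)\<close>.\<close>

lemma decreasing_weight_bound:
  fixes \<omega> :: "int \<Rightarrow> real"
  assumes "\<And>n. n \<ge> N0 \<Longrightarrow> \<omega> (n + 1) \<le> \<omega> n"
    and summ: "(\<lambda>n. \<bar>\<omega> n\<bar>) summable_on UNIV" and "N0 \<le> n"
  shows "real_of_int (n - N0) * \<omega> n \<le> (\<Sum>\<^sub>\<infinity>k. \<bar>\<omega> k\<bar>)"
proof -
  have "real_of_int (n - N0) * \<omega> n = (\<Sum>k\<in>{N0..<n}. \<omega> n)"
    using \<open>N0 \<le> n\<close> by simp
  also have "\<dots> \<le> (\<Sum>k\<in>{N0..<n}. \<bar>\<omega> k\<bar>)"
    by (intro sum_mono order_trans[OF decreasing_from[of N0 \<omega>, OF assms(1)] abs_ge_self]) auto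
  also have "\<dots> \<le> (\<Sum>\<^sub>\<infinity>k. \<bar>\<omega> k\<bar>)"
    by (intro finite_sum_le_infsum summ) auto
  finally show ?thesis .
qed

lemma sum_int_telescope:
  fixes f :: "int \<Rightarrow> real"
  assumes "a \<le> b"
  shows "(\<Sum>n\<in>{a..<b}. f (n + 1) - f n) = f b - f a"
  using assms
proof (induction b rule: int_ge_induct)
  case (step i)
  have "{a..<i + 1} = insert i {a..<i}" using step.hyps by auto
  then show ?case using step.IH by simp
qed simp

text \<open>For \<open>0 \<le> y \<le> x\<close> one has \<open>(x - y)\<^sup>2 \<le> x\<^sup>2 - y\<^sup>2\<close>, so the squared increments of a monotone
  nonnegative sequence telescope. The tail \<open>\<rho>\<close> increases up to \<open>- N - 1\<close>, jumps to \<open>0\<close>, jumps up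
  again at \<open>N + 1\<close> and decreases afterwards. Each of these four stages contributes at most
  \<open>\<omega> (N + 1) ^ 2\<close>.\<close>

lemma sum_sq_diff_tail_le:
  fixes \<omega> :: "int \<Rightarrow> real"
  assumes dec: "\<And>n. n \<ge> N0 \<Longrightarrow> \<omega> (n + 1) \<le> \<omega> n"
    and nonneg: "\<And>n. 0 \<le> \<omega> n" and even: "\<And>n. \<omega> (- n) = \<omega> n"
    and N: "N0 \<le> N" "0 \<le> N" and "finite F"
  defines "\<rho> \<equiv> \<lambda>n. if \<bar>n\<bar> \<le> N then 0 else \<omega> n"
  shows "(\<Sum>n\<in>F. (\<rho> (n + 1) - \<rho> n)\<^sup>2) \<le> 4 * (\<omega> (N + 1))\<^sup>2"
proof -
  define c where "c = \<omega> (N + 1)"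
  \<comment> \<open>A nondecreasing potential whose increments dominate the squared increments of \<open>\<rho>\<close>; it rises
    from \<open>0\<close> to \<open>4 * c\<^sup>2\<close>, by \<open>c\<^sup>2\<close> in each of the four stages.\<close>
  define \<Phi> where "\<Phi> n = (if n < - N then (\<omega> n)\<^sup>2 else if n \<le> N then 2 * c\<^sup>2 else 4 * c\<^sup>2 - (\<omega> n)\<^sup>2)" for n
  have sq: "(x - y)\<^sup>2 \<le> x\<^sup>2 - y\<^sup>2" if "0 \<le> y" "y \<le> x" for x y :: real
  proof -
    have "y * y \<le> x * y" using that by (intro mult_right_mono) auto
    then show ?thesis by (simp add: power2_eq_square algebra_simps)
  qed
  have le_c: "(\<omega> n)\<^sup>2 \<le> c\<^sup>2" if "n > N" for n
    using decreasing_from[of N0 \<omega>, OF dec, of "N + 1" n] N that nonneg[of n]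
    by (intro power_mono) (auto simp: c_def)
  have step: "(\<rho> (n + 1) - \<rho> n)\<^sup>2 \<le> \<Phi> (n + 1) - \<Phi> n" for n
  proof -
    consider "n > N" | "n = N" | "- N \<le> n" "n < N" | "n = - N - 1" | "n < - N - 1" by linarith
    then show ?thesis
    proof cases
      case 1
      then have "(\<omega> n - \<omega> (n + 1))\<^sup>2 \<le> (\<omega> n)\<^sup>2 - (\<omega> (n + 1))\<^sup>2"
        using dec[of n] nonneg N by (intro sq) auto
      then show ?thesis using 1 N by (simp add: \<rho>_def \<Phi>_def power2_commute)
    next
      case 2
      then show ?thesis using N by (simp add: \<rho>_def \<Phi>_def c_def)
    next
      case 3
      then show ?thesis by (simp add: \<rho>_def \<Phi>_def abs_le_iff)
    next
      case 4
      then have "\<omega> n = c" using even[of "N + 1"] by (simp add: c_def)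
      then show ?thesis using 4 N by (simp add: \<rho>_def \<Phi>_def)
    next
      case 5
      have "(\<omega> (- n - 1) - \<omega> (- n))\<^sup>2 \<le> (\<omega> (- n - 1))\<^sup>2 - (\<omega> (- n))\<^sup>2"
        using dec[of "- n - 1"] nonneg N 5 by (intro sq) auto
      then show ?thesis using 5 N even[of n] even[of "n + 1"] by (simp add: \<rho>_def \<Phi>_def)
    qed
  qed
  have \<Phi>: "0 \<le> \<Phi> n" "\<Phi> n \<le> 4 * c\<^sup>2" for n
  proof -
    have "0 \<le> c\<^sup>2" by simp
    moreover have "(\<omega> n)\<^sup>2 \<le> c\<^sup>2" if "\<bar>n\<bar> > N"
      using le_c[of n] le_c[of "- n"] even[of n] that by (cases "n > N") auto
    ultimately have "(\<omega> n)\<^sup>2 \<le> 4 * c\<^sup>2" if "\<bar>n\<bar> > N"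
      using that by linarith
    then show "0 \<le> \<Phi> n" "\<Phi> n \<le> 4 * c\<^sup>2"
      using N by (auto simp: \<Phi>_def)
  qed
  obtain K where K: "F \<subseteq> {- K..<K}" "0 \<le> K"
  proof
    have "\<bar>n\<bar> \<le> (\<Sum>n\<in>F. \<bar>n\<bar>)" if "n \<in> F" for n
      using that \<open>finite F\<close> by (intro member_le_sum) auto
    then show "F \<subseteq> {- ((\<Sum>n\<in>F. \<bar>n\<bar>) + 1)..<(\<Sum>n\<in>F. \<bar>n\<bar>) + 1}"
      by (force simp: abs_le_iff)
    show "0 \<le> (\<Sum>n\<in>F. \<bar>n\<bar>) + 1"
      by (simp add: sum_nonneg)
  qed
  have "(\<Sum>n\<in>F. (\<rho> (n + 1) - \<rho> n)\<^sup>2) \<le> (\<Sum>n\<in>{- K..<K}. (\<rho> (n + 1) - \<rho> n)\<^sup>2)"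
    using K by (intro sum_mono2) auto
  also have "\<dots> \<le> (\<Sum>n\<in>{- K..<K}. \<Phi> (n + 1) - \<Phi> n)"
    by (intro sum_mono step)
  also have "\<dots> = \<Phi> K - \<Phi> (- K)"
    using K by (intro sum_int_telescope) auto
  also have "\<dots> \<le> 4 * c\<^sup>2"
    using \<Phi>(2)[of K] \<Phi>(1)[of "- K"] by linarith
  finally show ?thesis by (simp add: c_def)
qed

section \<open>The propagator applied to a dipole\<close>

lemma norm_scalar_op_le: "norm (scalar_op c) \<le> cmod c"
  by (rule norm_blinfun_bound) (auto simp: scalar_op.rep_eq norm_cscale)

lemma norm_delta_diff: "(norm (delta 1 - delta 0 :: int ell2))\<^sup>2 = 2"
proof -
  let ?g = "delta 1 - delta 0 :: int ell2"
  have "(norm ?g)\<^sup>2 = (\<Sum>\<^sub>\<infinity>n\<in>{0, 1}. (cmod (coord ?g n))\<^sup>2)"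
    unfolding norm_ell2_square by (intro infsum_cong_neutral) (auto simp: delta.rep_eq)
  then show ?thesis by (simp add: delta.rep_eq)
qed

lemma exp_le_two_power:
  assumes "2 * x \<le> real n"
  shows "exp x \<le> 2 ^ n"
proof -
  have "exp (1/2 :: real) ^ 2 = exp 1"
    using exp_of_nat_mult[of 2 "1/2 :: real"] by simp
  then have "exp (1/2 :: real) ^ 2 \<le> 2 ^ 2" using exp_le by simp
  then have half: "exp (1/2 :: real) \<le> 2" by (rule power2_le_imp_le) simp
  have "exp x \<le> exp (real n * (1/2))" using assms by simp
  also have "\<dots> = exp (1/2) ^ n" by (rule exp_of_nat_mult)
  also have "\<dots> \<le> 2 ^ n" using half by (intro power_mono) auto
  finally show ?thesis .
qed

text \<open>The error budget is \<open>1\<close>, half of the squared norm \<open>2\<close> of the dipole: cutting off the weights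
  costs at most \<open>1/2\<close> in norm, and cutting off the power series at most \<open>3/8\<close>. Only the growth of the window with
  \<open>t\<^sup>2\<close> matters; its constant depends on the weights through \<open>N0\<close> and \<open>W\<close>.\<close>

lemma propagator_mass_quadratic_window:
  fixes \<omega> :: "int \<Rightarrow> real"
  assumes cw: "crystal_weights \<omega>" and dec: "\<And>n. n \<ge> N0 \<Longrightarrow> \<omega> (n + 1) \<le> \<omega> n" and "0 \<le> N0"
  defines "W \<equiv> (\<Sum>\<^sub>\<infinity>k. \<bar>\<omega> k\<bar>)"
  assumes t: "1 \<le> t"
  shows "\<exists>F. finite F
    \<and> real (card F) \<le> (2 * (4 * W + 3) * (real_of_int N0 + 48 * W + 49) + 3) * t\<^sup>2
    \<and> 1 \<le> (\<Sum>n\<in>F. (cmod (coord (op_exp (scalar_op (- (\<i> * complex_of_real t)) o\<^sub>L crystal \<omega>)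
              (delta 1 - delta 0)) n))\<^sup>2)"
proof -
  have summ: "(\<lambda>n. \<bar>\<omega> n\<bar>) summable_on UNIV" and nonneg: "\<And>n. 0 \<le> \<omega> n" and even: "\<And>n. \<omega> (- n) = \<omega> n"
    using cw by (auto simp: crystal_weights_def)
  have W: "0 \<le> W" unfolding W_def by (rule infsum_nonneg) auto
  define c where "c = - (\<i> * complex_of_real t)"
  \<comment> \<open>The factor \<open>48\<close> makes \<open>4 * norm g * norm (A g - B g)\<close> at most \<open>1/4\<close>; using \<open>W + 1\<close> instead of
    \<open>W\<close> covers vanishing weights.\<close>
  define m where "m = \<lceil>48 * (W + 1) * t\<rceil>"
  define N where "N = N0 + m"
  have m: "48 * (W + 1) * t \<le> real_of_int m" "real_of_int m \<le> 48 * (W + 1) * t + 1" 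
    unfolding m_def by linarith+
  have m0: "0 \<le> m" using m(1) W t
    by (metis le_of_int_ceiling m_def mult_nonneg_nonneg of_int_0_le_iff order_trans zero_le_numeral add_nonneg_nonneg zero_le_one)
  define \<sigma> where "\<sigma> n = (if \<bar>n\<bar> \<le> N then \<omega> n else 0)" for n
  define \<rho> where "\<rho> n = (if \<bar>n\<bar> \<le> N then 0 else \<omega> n)" for n
  have summ\<sigma>: "(\<lambda>n. \<bar>\<sigma> n\<bar>) summable_on UNIV"
    by (rule summable_on_comparison_test[OF summ]) (auto simp: \<sigma>_def)
  have cw\<sigma>: "crystal_weights \<sigma>"
    using summ\<sigma> nonneg even by (simp add: crystal_weights_def \<sigma>_def)
  define A where "A = scalar_op c o\<^sub>L crystal \<omega>"
  define B where "B = scalar_op c o\<^sub>L crystal \<sigma>"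
  define g where "g = (delta 1 - delta 0 :: int ell2)"
  have g: "(norm g)\<^sup>2 = 2" unfolding g_def by (rule norm_delta_diff)
  have g_le: "norm g \<le> 3/2"
    by (rule power2_le_imp_le) (simp_all add: g power2_eq_square[of "3/2 :: real"])

  have comm: "A o\<^sub>L B = B o\<^sub>L A"
  proof (rule blinfun_eqI)
    fix u
    have "scalar_op c (crystal \<omega> u) = crystal \<omega> (scalar_op c u)"
      "scalar_op c (crystal \<sigma> u) = crystal \<sigma> (scalar_op c u)"
      "crystal \<omega> (crystal \<sigma> u) = crystal \<sigma> (crystal \<omega> u)" for u
      using scalar_op_crystal_commute[OF summ, of c] scalar_op_crystal_commute[OF summ\<sigma>, of c]
        crystal_commute[OF summ summ\<sigma>] by (metis blinfun_apply_blinfun_compose)+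
    then show "(A o\<^sub>L B) u = (B o\<^sub>L A) u" by (simp add: A_def B_def)
  qed

  have coordAB: "coord (A g - B g) n = c * complex_of_real (\<rho> (- n + 1) - \<rho> (- n))" for n
    by (simp add: A_def B_def g_def scalar_op.rep_eq cscale.rep_eq blinfun.diff_right
        coord_crystal_delta[OF summ] coord_crystal_delta[OF summ\<sigma>] \<rho>_def \<sigma>_def algebra_simps)
  have "(norm (A g - B g))\<^sup>2 \<le> t\<^sup>2 * (4 * (\<omega> (N + 1))\<^sup>2)"
    unfolding norm_ell2_square
  proof (rule infsum_le_finite_sums[OF coord_summable])
    fix F :: "int set" assume F: "finite F"
    have "(\<Sum>n\<in>F. (cmod (coord (A g - B g) n))\<^sup>2) = (\<Sum>n\<in>F. t\<^sup>2 * (\<rho> (- n + 1) - \<rho> (- n))\<^sup>2)"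
      unfolding coordAB norm_mult power_mult_distrib norm_of_real
      using t by (simp add: c_def norm_mult)
    also have "\<dots> = t\<^sup>2 * (\<Sum>n\<in>uminus ` F. (\<rho> (n + 1) - \<rho> n)\<^sup>2)"
      by (simp add: sum.reindex sum_distrib_left)
    also have "\<dots> \<le> t\<^sup>2 * (4 * (\<omega> (N + 1))\<^sup>2)"
      unfolding \<rho>_def using m0 \<open>0 \<le> N0\<close> F
      by (intro mult_left_mono sum_sq_diff_tail_le[OF dec nonneg even]) (auto simp: N_def)
    finally show "(\<Sum>n\<in>F. (cmod (coord (A g - B g) n))\<^sup>2) \<le> t\<^sup>2 * (4 * (\<omega> (N + 1))\<^sup>2)" .
  qed
  also have "\<dots> = (2 * (t * \<omega> (N + 1)))\<^sup>2" by (simp add: power_mult_distrib)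
  finally have "norm (A g - B g) \<le> 2 * (t * \<omega> (N + 1))"
    by (rule power2_le_imp_le) (use t nonneg in auto)
  also have "t * \<omega> (N + 1) \<le> 1 / 48"
  proof -
    have "48 * (W + 1) * t * \<omega> (N + 1) \<le> real_of_int (N + 1 - N0) * \<omega> (N + 1)"
      using m(1) by (intro mult_right_mono nonneg) (simp add: N_def)
    also have "\<dots> \<le> W"
      unfolding W_def using m0 by (intro decreasing_weight_bound[OF dec summ]) (auto simp: N_def)
    finally have "(W + 1) * (48 * (t * \<omega> (N + 1))) \<le> (W + 1) * 1"
      by (simp add: algebra_simps)
    then have "48 * (t * \<omega> (N + 1)) \<le> 1"
      by (rule mult_left_le_imp_le) (use W in simp)
    then show ?thesis by simp
  qed
  finally have ABg: "norm (A g - B g) \<le> 1 / 24" by simp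
  have "(norm (op_exp A g - op_exp B g))\<^sup>2 \<le> 4 * norm g * norm (A g - B g)"
    unfolding A_def B_def c_def
    by (intro op_exp_diff_skew_commuting inner_crystal_skew cw cw\<sigma> comm[unfolded A_def B_def c_def])
  also have "\<dots> \<le> 4 * (3/2) * (1/24)"
    using g_le ABg by (intro mult_mono) auto
  also have "\<dots> = (1/2)\<^sup>2" by (simp add: power2_eq_square)
  finally have dist1: "norm (op_exp A g - op_exp B g) \<le> 1/2"
    by (rule power2_le_imp_le) simp

  \<comment> \<open>With \<open>L0 \<ge> 4 * W * t\<close> the factor \<open>exp (2 * norm B)\<close> of the tail bound is absorbed by
    \<open>2 ^ L0\<close>; the two further terms give the factor \<open>1/4\<close>.\<close>
  define L0 where "L0 = nat \<lceil>4 * W * t\<rceil>"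
  define L where "L = L0 + 2"
  have L0: "4 * W * t \<le> real L0" "real L0 \<le> 4 * W * t + 1"
    using W t unfolding L0_def by (auto intro: real_nat_ceiling_ge)
  define v where "v = (\<Sum>k<L. (op_power B k g) /\<^sub>R fact k)"
  have "norm B \<le> norm (scalar_op c :: int ell2 \<Rightarrow>\<^sub>L int ell2) * norm (crystal \<sigma>)"
    unfolding B_def by (rule norm_blinfun_compose)
  also have "\<dots> \<le> t * W"
  proof (rule mult_mono)
    show "norm (scalar_op c :: int ell2 \<Rightarrow>\<^sub>L int ell2) \<le> t"
      using norm_scalar_op_le[of c] t by (simp add: c_def norm_mult)
    have "norm (crystal \<sigma>) \<le> (\<Sum>\<^sub>\<infinity>k. \<bar>\<sigma> k\<bar>)" by (rule norm_crystal_le[OF summ\<sigma>])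
    also have "\<dots> \<le> W" unfolding W_def by (rule infsum_mono[OF summ\<sigma> summ]) (simp add: \<sigma>_def)
    finally show "norm (crystal \<sigma>) \<le> W" .
  qed (use t in auto)
  finally have "exp (2 * norm B) \<le> 2 ^ L0"
    using L0(1) by (intro exp_le_two_power) (simp add: mult_ac)
  then have "(1/2) ^ L * exp (2 * norm B) \<le> (1/2) ^ L * 2 ^ L0"
    by (rule mult_left_mono) simp
  also have "\<dots> = 1/4"
    by (simp add: L_def power_add power_divide power2_eq_square)
  finally have tail: "norm (op_exp B - (\<Sum>k<L. op_power B k /\<^sub>R fact k)) \<le> 1/4"
    using op_exp_tail_bound[of B L] by linarith
  have "op_exp B g - v = (op_exp B - (\<Sum>k<L. op_power B k /\<^sub>R fact k)) g"
    by (simp add: v_def blinfun.diff_left blinfun.sum_left blinfun.scaleR_left)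
  then have "norm (op_exp B g - v) \<le> norm (op_exp B - (\<Sum>k<L. op_power B k /\<^sub>R fact k)) * norm g"
    by (simp add: norm_blinfun)
  also have "\<dots> \<le> 1/4 * (3/2)"
    using tail g_le by (intro mult_mono) auto
  finally have dist2: "norm (op_exp A g - v) \<le> 1"
    using dist1 norm_triangle_ineq[of "op_exp A g - op_exp B g" "op_exp B g - v"] by simp

  define R where "R = 1 + int L * N"
  define F where "F = {- R..R}"
  have N: "0 \<le> N" using m0 \<open>0 \<le> N0\<close> by (simp add: N_def)
  have supp: "coord v n = 0" if "n \<notin> F" for n
  proof -
    have "coord v n = (\<Sum>k<L. coord (op_power B k g /\<^sub>R fact k) n)"
      unfolding v_def by (rule linear_sum[OF bounded_linear.linear[OF bounded_linear_coord]])
    also have "\<dots> = 0"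
    proof (rule sum.neutral, rule ballI)
      fix k assume "k \<in> {..<L}"
      then have "int k * N \<le> int L * N" using N by (intro mult_right_mono) auto
      then have "\<bar>n\<bar> > 1 + int k * N" using that by (auto simp: F_def R_def)
      then have "coord (op_power B k g) n = 0"
        unfolding B_def
        by (intro coord_op_power_finite_range[OF summ\<sigma>, of N 1]) (auto simp: \<sigma>_def g_def delta.rep_eq)
      then show "coord (op_power B k g /\<^sub>R fact k) n = 0" by simp
    qed
    finally show ?thesis .
  qed
  have "2 \<le> (\<Sum>n\<in>F. (cmod (coord (op_exp A g) n))\<^sup>2) + (norm (op_exp A g - v))\<^sup>2"
    using norm_sq_le_sum_plus_dist_sq[of F v "op_exp A g", OF _ supp]
      norm_op_exp_skew[of A g] inner_crystal_skew[OF cw] g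
    by (simp add: A_def c_def F_def)
  moreover have "(norm (op_exp A g - v))\<^sup>2 \<le> 1" using dist2 by (simp add: power_le_one)
  ultimately have "1 \<le> (\<Sum>n\<in>F. (cmod (coord (op_exp A g) n))\<^sup>2)" by linarith
  moreover have "real (card F) \<le> (2 * (4 * W + 3) * (real_of_int N0 + 48 * W + 49) + 3) * t\<^sup>2"
  proof -
    have "0 \<le> N * int L" using N by simp
    then have "int (card F) = 2 * (int L * N) + 3"
      by (simp add: F_def R_def)
    then have "real_of_int (int (card F)) = real_of_int (2 * (int L * N) + 3)"
      by (rule arg_cong)
    then have "real (card F) = 2 * (real L * real_of_int N) + 3"
      by simp
    also have "real L * real_of_int N \<le> ((4 * W + 3) * t) * ((real_of_int N0 + 48 * W + 49) * t)"
    proof (rule mult_mono)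
      show "real L \<le> (4 * W + 3) * t" using L0(2) t by (simp add: L_def algebra_simps)
      have "real_of_int N0 * 1 \<le> real_of_int N0 * t"
        using t \<open>0 \<le> N0\<close> by (intro mult_left_mono) auto
      then show "real_of_int N \<le> (real_of_int N0 + 48 * W + 49) * t"
        using m(2) t by (simp add: N_def algebra_simps)
    qed (use W t N in auto)
    also have "2 * (((4 * W + 3) * t) * ((real_of_int N0 + 48 * W + 49) * t)) + 3
        \<le> 2 * (((4 * W + 3) * t) * ((real_of_int N0 + 48 * W + 49) * t)) + 3 * t\<^sup>2"
      using t by (simp add: one_le_power)
    also have "\<dots> = (2 * (4 * W + 3) * (real_of_int N0 + 48 * W + 49) + 3) * t\<^sup>2"
      by (simp add: power2_eq_square algebra_simps)
    finally show ?thesis by simp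
  qed
  ultimately show ?thesis
    unfolding A_def c_def g_def by (intro exI[of _ F]) (auto simp: F_def)
qed

theorem corollary3p6:
  fixes \<omega> :: "int \<Rightarrow> real"
  assumes "crystal_weights \<omega>"
    and "\<forall>\<^sub>F n in at_top. \<omega> (n + 1) \<le> \<omega> n"
  shows "Limsup at_top (\<lambda>t::real.
           ereal t * l1_linf_norm (op_exp (scalar_op (- (\<i> * complex_of_real t)) o\<^sub>L crystal \<omega>))) > 0"
proof -
  obtain N1 where N1: "\<And>n. n \<ge> N1 \<Longrightarrow> \<omega> (n + 1) \<le> \<omega> n"
    using assms(2) by (auto simp: eventually_at_top_linorder)
  define N0 where "N0 = max 0 N1"
  define W where "W = (\<Sum>\<^sub>\<infinity>k. \<bar>\<omega> k\<bar>)"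
  define K where "K = 2 * (4 * W + 3) * (real_of_int N0 + 48 * W + 49) + 3"
  have "0 \<le> W" unfolding W_def by (rule infsum_nonneg) auto
  then have K: "0 < K" by (auto simp: K_def N0_def intro!: add_nonneg_pos mult_nonneg_nonneg)
  \<comment> \<open>Entries below \<open>c / t\<close> would give \<open>U g\<close> mass at most \<open>K * t\<^sup>2 * (2 * c / t)\<^sup>2 = 1/4\<close> on the window.\<close>
  define c where "c = 1 / (4 * sqrt K)"
  have c: "0 < c" "(2 * c)\<^sup>2 * K = 1/4" using K by (simp_all add: c_def power_divide power_mult_distrib)
  have bound: "ereal c \<le> ereal t * l1_linf_norm (op_exp (scalar_op (- (\<i> * complex_of_real t)) o\<^sub>L crystal \<omega>))"
    if t: "1 \<le> t" for t
  proof (rule ccontr)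
    define U where "U = op_exp (scalar_op (- (\<i> * complex_of_real t)) o\<^sub>L crystal \<omega>)"
    assume "\<not> ereal c \<le> ereal t * l1_linf_norm (op_exp (scalar_op (- (\<i> * complex_of_real t)) o\<^sub>L crystal \<omega>))"
    then have small: "ereal t * l1_linf_norm U < ereal c" by (simp add: U_def)
    have entry: "t * cmod (coord (U (delta m)) n) \<le> c" for n m
    proof -
      have "ereal (cmod (cinner (delta n) (U (delta m)))) \<le> l1_linf_norm U"
        unfolding l1_linf_norm_def by (rule SUP_upper2[of "(n, m)"]) auto
      then have "ereal t * ereal (cmod (cinner (delta n) (U (delta m)))) \<le> ereal t * l1_linf_norm U"
        using t by (intro ereal_mult_left_mono) auto
      from le_less_trans[OF this small] have "ereal (t * cmod (coord (U (delta m)) n)) < ereal c"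
        by (simp add: cinner_delta_left)
      then show ?thesis by simp
    qed
    have diff: "t\<^sup>2 * (cmod (coord (U (delta 1 - delta 0)) n))\<^sup>2 \<le> (2 * c)\<^sup>2" for n
    proof -
      have "t * cmod (coord (U (delta 1 - delta 0)) n)
          \<le> t * (cmod (coord (U (delta 1)) n) + cmod (coord (U (delta 0)) n))"
        using t by (intro mult_left_mono) (auto simp: blinfun.diff_right norm_triangle_ineq4)
      also have "\<dots> \<le> 2 * c"
        using entry[of 1 n] entry[of 0 n] by (simp add: distrib_left)
      finally have "(t * cmod (coord (U (delta 1 - delta 0)) n))\<^sup>2 \<le> (2 * c)\<^sup>2"
        using t by (intro power_mono) auto
      then show ?thesis by (simp add: power_mult_distrib)
    qed
    obtain F where F: "finite F" "real (card F) \<le> K * t\<^sup>2"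
        "1 \<le> (\<Sum>n\<in>F. (cmod (coord (U (delta 1 - delta 0)) n))\<^sup>2)"
      using propagator_mass_quadratic_window[OF assms(1), of N0 t] N1 t
      unfolding U_def K_def W_def N0_def by auto
    have "t\<^sup>2 * 1 \<le> t\<^sup>2 * (\<Sum>n\<in>F. (cmod (coord (U (delta 1 - delta 0)) n))\<^sup>2)"
      using F(3) by (intro mult_left_mono) auto
    also have "\<dots> \<le> (\<Sum>n\<in>F. (2 * c)\<^sup>2)"
      unfolding sum_distrib_left by (intro sum_mono diff)
    also have "\<dots> = real (card F) * (2 * c)\<^sup>2" by simp
    also have "\<dots> \<le> (K * t\<^sup>2) * (2 * c)\<^sup>2" by (rule mult_right_mono[OF F(2)]) simp
    also have "\<dots> = ((2 * c)\<^sup>2 * K) * t\<^sup>2" by (simp only: mult_ac)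
    also have "\<dots> = t\<^sup>2 / 4" by (simp only: c(2))
    finally show False using t by simp
  qed
  have "0 < ereal c" using c by simp
  also have "ereal c \<le> Limsup at_top (\<lambda>t::real.
      ereal t * l1_linf_norm (op_exp (scalar_op (- (\<i> * complex_of_real t)) o\<^sub>L crystal \<omega>)))"
    by (rule le_Limsup) (auto intro: eventually_mono[OF eventually_ge_at_top[of 1]] bound)
  finally show ?thesis .
qed

end
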